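(* Let $B$ be a content $S$-semialgebra over a semiring $S$. Then the following statements hold: (1) the function $\phi:\operatorname{Min}(S)\to\operatorname{Min}(B)$ given by $\mathbf{p}\mapsto\mathbf{p}B$ is a bijection; (2) $\operatorname{Nil}(B)=\operatorname{Nil}(S)B$; in particular, $B$ is reduced if and only if $S$ is reduced.
   Context: A semiring $(S,+,\cdot,0,1)$ is commutative: $(S,+,0)$ and $(S,\cdot,1)$ are commutative monoids, $1\neq 0$, multiplication distributes over addition, and $s\cdot 0=0$ for all $s$. An ideal is a nonempty subset closed under addition and under multiplication by elements of $S$; $\operatorname{Id}(S)$ is the set of ideals of $S$. A prime ideal is an ideal $P\neq S$ such that $ab\in P$ implies $a\in P$ or $b\in P$. $\operatorname{Min}(S)$ is the set of minimal prime ideals of $S$, $\operatorname{Nil}(S)$ is the set of nilpotent elements of $S$, and $S$ is reduced if $\operatorname{Nil}(S)=(0)$. An $S$-semialgebra is a semiring $B$ with a semiring homomorphism $\lambda:S\to B$ (preserving $+,\cdot,0,1$), with scalar product $s f=\lambda(s)f$; for an ideal $I$ of $S$, $IB=\{\sum_{i=1}^n a_if_i: a_i\in I, f_i\in B\}$ is the ideal of $B$ generated by $\lambda(I)$. $B$ is a content $S$-semialgebra if $\lambda$ is injective (so $S$ is viewed as a subsemiring of $B$) and there is a function $c:B\to\operatorname{Id}(S)$ such that: (i) for all $f\in B$ and all ideals $I$ of $S$, $f\in IB$ iff $c(f)\subseteq I$; (ii) $c(sf)=s\,c(f)$ for all $s\in S$, $f\in B$, and $c(1)=S$; (iii) for all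 $f,g\in B$ there is an integer $m\ge 0$ with $c(f)^{m+1}c(g)=c(f)^mc(fg)$. Products of ideals are sets of finite sums of products, and $I^0=S$. *)

theory Defs
  imports Main
begin

text \<open>
  Semirings are types of class \<^class>\<open>comm_semiring_1\<close>: commutative, with \<open>0 \<noteq> 1\<close> and with
  \<open>0\<close> multiplicatively absorbing; additive cancellation is not assumed. Thus the whole
  semiring \<open>S\<close> is \<open>UNIV\<close>.
\<close>

definition is_ideal :: "'a::comm_semiring_1 set \<Rightarrow> bool" where
  "is_ideal I \<longleftrightarrow> I \<noteq> {} \<and> (\<forall>x\<in>I. \<forall>y\<in>I. x + y \<in> I) \<and> (\<forall>s. \<forall>x\<in>I. s * x \<in> I)"

definition is_prime_ideal :: "'a::comm_semiring_1 set \<Rightarrow> bool" where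
  "is_prime_ideal P \<longleftrightarrow>
     is_ideal P \<and> P \<noteq> UNIV \<and> (\<forall>a b. a * b \<in> P \<longrightarrow> a \<in> P \<or> b \<in> P)"

definition min_primes :: "'a::comm_semiring_1 set set" where
  "min_primes = {P. is_prime_ideal P \<and> (\<forall>Q. is_prime_ideal Q \<and> Q \<subseteq> P \<longrightarrow> Q = P)}"

definition Nil_set :: "'a::comm_semiring_1 set" where
  "Nil_set = {x. \<exists>n. x ^ n = 0}"

definition reduced :: "'a::comm_semiring_1 itself \<Rightarrow> bool" where
  "reduced _ \<longleftrightarrow> Nil_set = {0::'a}"

definition ideal_mult :: "'a::comm_semiring_1 set \<Rightarrow> 'a set \<Rightarrow> 'a set" where
  "ideal_mult I J =
     {(\<Sum>i<n. a i * b i) | (n::nat) a b. \<forall>i<n. a i \<in> I \<and> b i \<in> J}"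

primrec ideal_power :: "'a::comm_semiring_1 set \<Rightarrow> nat \<Rightarrow> 'a set" where
  "ideal_power I 0 = UNIV"
| "ideal_power I (Suc n) = ideal_mult I (ideal_power I n)"

definition is_semiring_hom :: "('a::comm_semiring_1 \<Rightarrow> 'b::comm_semiring_1) \<Rightarrow> bool" where
  "is_semiring_hom h \<longleftrightarrow>
     h 0 = 0 \<and> h 1 = 1 \<and>
     (\<forall>x y. h (x + y) = h x + h y) \<and> (\<forall>x y. h (x * y) = h x * h y)"

text \<open>
  A semialgebra over \<open>'a\<close> is a type \<open>'b\<close> with a structure map \<open>h :: 'a \<Rightarrow> 'b\<close>, the scalar
  product of \<open>s\<close> and \<open>f\<close> being \<open>h s * f\<close>; \<open>extend_ideal h I\<close> is the extension \<open>IB\<close>.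
\<close>

definition extend_ideal ::
    "('a::comm_semiring_1 \<Rightarrow> 'b::comm_semiring_1) \<Rightarrow> 'a set \<Rightarrow> 'b set" where
  "extend_ideal h I =
     {(\<Sum>i<n. h (a i) * f i) | (n::nat) a f. \<forall>i<n. a i \<in> I}"

definition is_content_function ::
    "('a::comm_semiring_1 \<Rightarrow> 'b::comm_semiring_1) \<Rightarrow> ('b \<Rightarrow> 'a set) \<Rightarrow> bool" where
  "is_content_function h c \<longleftrightarrow>
     (\<forall>f. is_ideal (c f)) \<and>
     (\<forall>f I. is_ideal I \<longrightarrow> (f \<in> extend_ideal h I \<longleftrightarrow> c f \<subseteq> I)) \<and>
     (\<forall>s f. c (h s * f) = (\<lambda>x. s * x) ` c f) \<and>
     c 1 = UNIV \<and>
     (\<forall>f g. \<exists>m. ideal_mult (ideal_power (c f) (m + 1)) (c g)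
              = ideal_mult (ideal_power (c f) m) (c (f * g)))"

definition content_semialgebra :: "('a::comm_semiring_1 \<Rightarrow> 'b::comm_semiring_1) \<Rightarrow> bool" where
  "content_semialgebra h \<longleftrightarrow>
     is_semiring_hom h \<and> inj h \<and> (\<exists>c. is_content_function h c)"

end

theory Submission
  imports Defs
begin

text \<open>
  Everything rests on one consequence of the content formula
  \<open>c(f)\<^sup>m\<^sup>+\<^sup>1 c(g) = c(f)\<^sup>m c(fg)\<close>: if \<open>c(fg)\<close> lies in an ideal \<open>I\<close>, then
  \<open>a\<^sup>m\<^sup>+\<^sup>1 b \<in> I\<close> for all \<open>a \<in> c(f)\<close> and \<open>b \<in> c(g)\<close>, where \<open>m\<close> depends only on \<open>f\<close> and \<open>g\<close>
  (\<open>content_product_power\<close>).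

  Taking a prime \<open>p\<close> for \<open>I\<close> shows that \<open>pB\<close> is prime (\<open>extend_prime\<close>). Extension of ideals is
  left adjoint to contraction along \<open>h\<close>, and contracting \<open>IB\<close> gives back \<open>I\<close> because
  \<open>c(h(s)) = sS\<close> (\<open>contract_extend\<close>). So \<open>p \<mapsto> pB\<close> embeds the poset of primes of \<open>S\<close>
  into that of \<open>B\<close>, with the contraction as a retraction, and every prime \<open>Q\<close> of \<open>B\<close> contains the
  prime \<open>(Q \<inter> S)B\<close>. These two facts alone force the minimal elements to correspond.

  For the nilradical, let \<open>f\<^sup>n = 0\<close> and \<open>a \<in> c(f)\<close>. Taking annihilators of powers of \<open>a\<close>
  for \<open>I\<close>, descending induction on \<open>j\<close> shows that some power of \<open>a\<close> annihilates \<open>c(f\<^sup>j)\<close>: this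
  holds at \<open>j = n\<close> as \<open>c(0) = 0\<close>, and at \<open>j = 0\<close> it says that \<open>a\<close> is nilpotent as \<open>c(1) = S\<close>.
  Hence \<open>c(f) \<subseteq> Nil(S)\<close>, that is \<open>f \<in> Nil(S)B\<close>. This avoids representing the nilradical as an
  intersection of primes, and with it an appeal to Zorn's lemma.
\<close>

section \<open>Ideals and nilpotent elements\<close>

lemma ideal_add: "is_ideal I \<Longrightarrow> x \<in> I \<Longrightarrow> y \<in> I \<Longrightarrow> x + y \<in> I"
  by (simp add: is_ideal_def)

lemma ideal_mult_left: "is_ideal I \<Longrightarrow> x \<in> I \<Longrightarrow> s * x \<in> I"
  by (simp add: is_ideal_def)

lemma ideal_mult_right: "is_ideal I \<Longrightarrow> x \<in> I \<Longrightarrow> x * s \<in> I"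
  by (metis ideal_mult_left mult.commute)

lemma ideal_zero: "is_ideal I \<Longrightarrow> 0 \<in> I"
  unfolding is_ideal_def by (metis ex_in_conv mult_zero_left)

lemma ideal_sum:
  assumes "is_ideal I" and "\<And>i. i \<in> A \<Longrightarrow> f i \<in> I"
  shows "sum f A \<in> I"
  using assms(2)
  by (induction A rule: infinite_finite_induct)
    (auto simp: ideal_zero[OF assms(1)] intro: ideal_add[OF assms(1)])

lemma ideal_eq_UNIV: "is_ideal I \<Longrightarrow> 1 \<in> I \<Longrightarrow> I = UNIV"
  using ideal_mult_left[of I 1] by auto

lemma ideal_mult_subset:
  assumes "is_ideal K" and "J \<subseteq> K"
  shows "ideal_mult I J \<subseteq> K"
  unfolding ideal_mult_def
  using assms by (auto intro!: ideal_sum ideal_mult_left)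

lemma mult_in_ideal_mult:
  assumes "a \<in> I" and "b \<in> J"
  shows "a * b \<in> ideal_mult I J"
proof -
  have "a * b = (\<Sum>i<(1::nat). a * b)"
    by simp
  then show ?thesis
    unfolding ideal_mult_def using assms by fastforce
qed

lemma power_in_ideal_power: "a \<in> I \<Longrightarrow> a ^ n \<in> ideal_power I n"
  by (induction n) (auto intro: mult_in_ideal_mult)

lemma prime_power_mem:
  assumes "is_prime_ideal P" and "a ^ n \<in> P"
  shows "a \<in> P"
proof -
  have P: "is_ideal P" "P \<noteq> UNIV" "\<And>x y. x * y \<in> P \<Longrightarrow> x \<in> P \<or> y \<in> P"
    using assms(1) by (auto simp: is_prime_ideal_def)
  show ?thesis
    using assms(2)
  proof (induction n)
    case 0
    then show ?case
      using ideal_eq_UNIV[OF P(1)] P(2) by simp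
  next
    case (Suc n)
    then show ?case
      using P(3) by auto
  qed
qed

lemma is_ideal_annihilator: "is_ideal {y. (a::'a::comm_semiring_1) * y = 0}"
  unfolding is_ideal_def
  by (auto simp: distrib_left mult.left_commute intro: exI[of _ 0])

lemma power_zero_mono:
  fixes x :: "'a::comm_semiring_1"
  assumes "x ^ n = 0" and "n \<le> k"
  shows "x ^ k = 0"
  using assms by (metis le_add_diff_inverse mult_zero_left power_add)

lemma is_ideal_Nil_set: "is_ideal (Nil_set :: 'a::comm_semiring_1 set)"
  unfolding is_ideal_def
proof (intro conjI ballI allI)
  have "(0::'a) ^ 1 = 0"
    by simp
  then show "(Nil_set :: 'a set) \<noteq> {}"
    unfolding Nil_set_def by blast
next
  fix x y :: 'a
  assume "x \<in> Nil_set" and "y \<in> Nil_set"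
  then obtain n m where n: "x ^ n = 0" and m: "y ^ m = 0"
    unfolding Nil_set_def by blast
  have "of_nat ((n + m) choose k) * x ^ k * y ^ (n + m - k) = 0" for k
  proof (cases "n \<le> k")
    case True
    then show ?thesis
      by (simp add: power_zero_mono[OF n])
  next
    case False
    then show ?thesis
      by (simp add: power_zero_mono[OF m])
  qed
  then have "(x + y) ^ (n + m) = 0"
    by (simp add: binomial_ring)
  then show "x + y \<in> Nil_set"
    unfolding Nil_set_def by blast
next
  fix s x :: 'a
  assume "x \<in> Nil_set"
  then show "s * x \<in> Nil_set"
    unfolding Nil_set_def by (auto simp: power_mult_distrib) (metis mult_zero_right)
qed

section \<open>Extension and contraction of ideals\<close>

lemma mult_in_extend_ideal:
  assumes "a \<in> I"
  shows "h a * f \<in> extend_ideal h I"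
proof -
  have "h a * f = (\<Sum>i<(1::nat). h a * f)"
    by simp
  then show ?thesis
    unfolding extend_ideal_def using assms by fastforce
qed

lemma is_ideal_extend_ideal:
  fixes h :: "'a::comm_semiring_1 \<Rightarrow> 'b::comm_semiring_1"
  shows "is_ideal (extend_ideal h I)"
  unfolding is_ideal_def
proof (intro conjI ballI allI)
  have "(\<Sum>i<(0::nat). h (undefined i) * undefined i) \<in> extend_ideal h I"
    unfolding extend_ideal_def by blast
  then show "extend_ideal h I \<noteq> {}"
    by blast
next
  fix x y
  assume xy: "x \<in> extend_ideal h I" "y \<in> extend_ideal h I"
  obtain n :: nat and a f where x: "x = (\<Sum>i<n. h (a i) * f i)" "\<forall>i<n. a i \<in> I"
    using xy(1) by (auto simp: extend_ideal_def)
  obtain m :: nat and b g where y: "y = (\<Sum>i<m. h (b i) * g i)" "\<forall>i<m. b i \<in> I"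
    using xy(2) by (auto simp: extend_ideal_def)
  define d where "d i = (if i < n then a i else b (i - n))" for i
  define k where "k i = (if i < n then f i else g (i - n))" for i
  have split: "(\<Sum>i<n + m. F i) = (\<Sum>i<n. F i) + (\<Sum>i<m. F (n + i))" for F :: "nat \<Rightarrow> 'b"
    by (induction m) (auto simp: add.assoc)
  have "x + y = (\<Sum>i<n + m. h (d i) * k i)"
    unfolding split by (simp add: x y d_def k_def)
  moreover have "\<forall>i<n + m. d i \<in> I"
    using x y by (auto simp: d_def)
  ultimately show "x + y \<in> extend_ideal h I"
    unfolding extend_ideal_def by blast
next
  fix s x
  assume "x \<in> extend_ideal h I"
  then obtain n :: nat and a f where x: "x = (\<Sum>i<n. h (a i) * f i)" "\<forall>i<n. a i \<in> I"
    by (auto simp: extend_ideal_def)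
  have "s * x = (\<Sum>i<n. h (a i) * (s * f i))"
    by (simp add: x sum_distrib_left mult.left_commute)
  then show "s * x \<in> extend_ideal h I"
    unfolding extend_ideal_def using x(2)
    by (intro CollectI exI[of _ n] exI[of _ a] exI[of _ "\<lambda>i. s * f i"]) simp
qed

lemma extend_subset_iff:
  assumes "is_ideal J"
  shows "extend_ideal h I \<subseteq> J \<longleftrightarrow> I \<subseteq> h -` J"
proof
  assume L: "extend_ideal h I \<subseteq> J"
  show "I \<subseteq> h -` J"
  proof
    fix a
    assume "a \<in> I"
    then have "h a * 1 \<in> extend_ideal h I"
      by (rule mult_in_extend_ideal)
    then show "a \<in> h -` J"
      using L by auto
  qed
next
  assume "I \<subseteq> h -` J"
  then show "extend_ideal h I \<subseteq> J"
    unfolding extend_ideal_def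
    by (auto intro!: ideal_sum[OF assms] ideal_mult_right[OF assms])
qed

lemma prime_contract:
  assumes "is_semiring_hom h" and "is_prime_ideal Q"
  shows "is_prime_ideal (h -` Q)"
proof -
  have h: "h 0 = 0" "h 1 = 1" "\<And>x y. h (x + y) = h x + h y" "\<And>x y. h (x * y) = h x * h y"
    using assms(1) by (auto simp: is_semiring_hom_def)
  have Q: "is_ideal Q" "Q \<noteq> UNIV" "\<And>x y. x * y \<in> Q \<Longrightarrow> x \<in> Q \<or> y \<in> Q"
    using assms(2) by (auto simp: is_prime_ideal_def)
  have "h -` Q \<noteq> {}"
    using ideal_zero[OF Q(1)] h(1) by (metis empty_iff vimageI2)
  then have "is_ideal (h -` Q)"
    unfolding is_ideal_def by (auto simp: h intro: ideal_add[OF Q(1)] ideal_mult_left[OF Q(1)])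
  moreover have "1 \<notin> h -` Q"
    using ideal_eq_UNIV[OF Q(1)] Q(2) by (auto simp: h(2))
  then have "h -` Q \<noteq> UNIV"
    by blast
  ultimately show ?thesis
    unfolding is_prime_ideal_def using Q(3) by (simp add: h)
qed

section \<open>Content functions\<close>

locale content_setting =
  fixes h :: "'a::comm_semiring_1 \<Rightarrow> 'b::comm_semiring_1" and c :: "'b \<Rightarrow> 'a set"
  assumes hom: "is_semiring_hom h" and content: "is_content_function h c"
begin

lemma is_ideal_content: "is_ideal (c f)"
  using content by (simp add: is_content_function_def)

lemma mem_extend_iff: "is_ideal I \<Longrightarrow> f \<in> extend_ideal h I \<longleftrightarrow> c f \<subseteq> I"
  using content by (simp add: is_content_function_def)

lemma content_scalar: "c (h s * f) = (\<lambda>x. s * x) ` c f"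
  using content by (simp add: is_content_function_def)

lemma content_one: "c 1 = UNIV"
  using content by (simp add: is_content_function_def)

lemma content_zero: "c 0 = {0}"
proof -
  have "h 0 = 0"
    using hom by (simp add: is_semiring_hom_def)
  then have "c 0 = (\<lambda>x. 0 * x) ` c 0"
    using content_scalar[of 0 0] by simp
  then show ?thesis
    using is_ideal_content[of 0] by (auto simp: is_ideal_def)
qed

text \<open>
  The content formula in terms of elements: the right-hand side \<open>c(f)\<^sup>m c(fg)\<close> lies in every
  ideal containing \<open>c(fg)\<close>. The exponent is independent of \<open>a\<close>, \<open>b\<close> and \<open>I\<close>; this uniformity
  in \<open>b\<close> is what allows the bounds on powers to be iterated in \<open>content_nilpotent\<close>.
\<close>

lemma content_product_power:
  obtains m where
    "\<And>I a b. is_ideal I \<Longrightarrow> c (f * g) \<subseteq> I \<Longrightarrow> a \<in> c f \<Longrightarrow> b \<in> c g \<Longrightarrow> a ^ Suc m * b \<in> I"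
proof -
  obtain m where m: "ideal_mult (ideal_power (c f) (Suc m)) (c g)
      = ideal_mult (ideal_power (c f) m) (c (f * g))"
    using content unfolding is_content_function_def by (metis Suc_eq_plus1)
  show thesis
  proof (rule that)
    fix I a b
    assume "is_ideal I" and "c (f * g) \<subseteq> I" and "a \<in> c f" and "b \<in> c g"
    have "a ^ Suc m * b \<in> ideal_mult (ideal_power (c f) (Suc m)) (c g)"
      using power_in_ideal_power[OF \<open>a \<in> c f\<close>] \<open>b \<in> c g\<close> by (rule mult_in_ideal_mult)
    then show "a ^ Suc m * b \<in> I"
      unfolding m using ideal_mult_subset[OF \<open>is_ideal I\<close> \<open>c (f * g) \<subseteq> I\<close>] by blast
  qed
qed

text \<open>Since \<open>c(h(s)) = s c(1) = sS\<close>, the condition \<open>h(s) \<in> IB\<close> reads \<open>sS \<subseteq> I\<close>.\<close>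

lemma contract_extend:
  assumes "is_ideal I"
  shows "h -` extend_ideal h I = I"
proof -
  have "h s \<in> extend_ideal h I \<longleftrightarrow> s \<in> I" for s
  proof -
    have "c (h s) = range (\<lambda>x. s * x)"
      using content_scalar[of s 1] by (simp add: content_one)
    then have "h s \<in> extend_ideal h I \<longleftrightarrow> range (\<lambda>x. s * x) \<subseteq> I"
      by (simp add: mem_extend_iff[OF assms])
    also have "\<dots> \<longleftrightarrow> s \<in> I"
      using ideal_mult_right[OF assms] by (auto dest: subsetD[OF _ rangeI[of _ 1]])
    finally show ?thesis .
  qed
  then show ?thesis
    by auto
qed

lemma extend_prime:
  assumes "is_prime_ideal p"
  shows "is_prime_ideal (extend_ideal h p)"
proof -
  have p: "is_ideal p" "p \<noteq> UNIV" "\<And>x y. x * y \<in> p \<Longrightarrow> x \<in> p \<or> y \<in> p"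
    using assms by (auto simp: is_prime_ideal_def)
  have "1 \<notin> extend_ideal h p"
    using p(2) by (auto simp: mem_extend_iff[OF p(1)] content_one)
  moreover have "f \<in> extend_ideal h p \<or> g \<in> extend_ideal h p"
    if fg: "f * g \<in> extend_ideal h p" for f g
  proof (rule ccontr)
    assume "\<not> ?thesis"
    then obtain a b where ab: "a \<in> c f" "a \<notin> p" "b \<in> c g" "b \<notin> p"
      by (auto simp: mem_extend_iff[OF p(1)])
    obtain m where "a ^ Suc m * b \<in> p"
      using content_product_power[of f g] p(1) fg ab by (metis mem_extend_iff)
    then show False
      using p(3) prime_power_mem[OF assms] ab by blast
  qed
  ultimately show ?thesis
    unfolding is_prime_ideal_def using is_ideal_extend_ideal by blast
qed

lemma content_nilpotent:
  assumes "f \<in> Nil_set"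
  shows "c f \<subseteq> Nil_set"
proof
  fix a
  assume a: "a \<in> c f"
  obtain n where n: "f ^ n = 0"
    using assms unfolding Nil_set_def by blast
  \<comment> \<open>Each factor \<open>f\<close> removed from \<open>f ^ Suc j\<close> costs a further power of \<open>a\<close>, until \<open>f ^ 0 = 1\<close>.\<close>
  have "\<exists>k. c (f ^ j) \<subseteq> {y. a ^ k * y = 0}" if "j \<le> n" for j
    using that
  proof (induction rule: inc_induct)
    case base
    then show ?case
      by (simp add: n content_zero)
  next
    case (step j)
    then obtain k where k: "c (f * f ^ j) \<subseteq> {y. a ^ k * y = 0}"
      by auto
    obtain m where "\<And>b. b \<in> c (f ^ j) \<Longrightarrow> a ^ Suc m * b \<in> {y. a ^ k * y = 0}"
      using content_product_power[of f "f ^ j"] k a is_ideal_annihilator by metis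
    then have "c (f ^ j) \<subseteq> {y. a ^ (k + Suc m) * y = 0}"
      by (auto simp: power_add mult.assoc simp del: power_Suc add_Suc_right)
    then show ?case
      by blast
  qed
  from this[of 0] obtain k where "UNIV \<subseteq> {y. a ^ k * y = 0}"
    by (auto simp: content_one)
  then have "a ^ k * 1 = 0"
    by blast
  then show "a \<in> Nil_set"
    unfolding Nil_set_def by auto
qed

lemma bij_betw_min_primes: "bij_betw (extend_ideal h) min_primes min_primes"
proof (rule bij_betw_byWitness[where f' = "\<lambda>Q. h -` Q"])
  have extend_min: "extend_ideal h p \<in> min_primes" if p: "p \<in> min_primes" for p
  proof -
    have prime: "is_prime_ideal p" and min: "\<And>q. is_prime_ideal q \<Longrightarrow> q \<subseteq> p \<Longrightarrow> q = p"
      using p by (auto simp: min_primes_def)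
    have "Q = extend_ideal h p" if Q: "is_prime_ideal Q" "Q \<subseteq> extend_ideal h p" for Q
    proof -
      have "h -` Q \<subseteq> p"
        using Q(2) contract_extend[of p] prime by (auto simp: is_prime_ideal_def)
      then have "h -` Q = p"
        by (intro min prime_contract[OF hom Q(1)])
      then have "extend_ideal h p \<subseteq> Q"
        using extend_subset_iff[of Q h p] Q(1) by (simp add: is_prime_ideal_def)
      then show ?thesis
        using Q(2) by blast
    qed
    then show ?thesis
      using extend_prime[OF prime] by (simp add: min_primes_def)
  qed
  then show "extend_ideal h ` min_primes \<subseteq> min_primes"
    by blast
  show "\<forall>p\<in>min_primes. h -` extend_ideal h p = p"
    using contract_extend by (simp add: min_primes_def is_prime_ideal_def)
  have extend_contract: "extend_ideal h (h -` Q) = Q" if "Q \<in> min_primes" for Q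
  proof -
    have Q: "is_prime_ideal Q" "\<And>R. is_prime_ideal R \<Longrightarrow> R \<subseteq> Q \<Longrightarrow> R = Q"
      using that by (auto simp: min_primes_def)
    show ?thesis
      using Q(1) by (intro Q(2) extend_prime prime_contract[OF hom])
        (simp_all add: extend_subset_iff is_prime_ideal_def)
  qed
  then show "\<forall>Q\<in>min_primes. extend_ideal h (h -` Q) = Q"
    by blast
  have "h -` Q \<in> min_primes" if Q: "Q \<in> min_primes" for Q
  proof -
    have prime: "is_prime_ideal Q" and min: "\<And>R. is_prime_ideal R \<Longrightarrow> R \<subseteq> Q \<Longrightarrow> R = Q"
      using Q by (auto simp: min_primes_def)
    have "q = h -` Q" if q: "is_prime_ideal q" "q \<subseteq> h -` Q" for q
    proof -
      have "extend_ideal h q \<subseteq> Q"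
        using extend_subset_iff[of Q h q] prime q(2) by (simp add: is_prime_ideal_def)
      then have "extend_ideal h q = Q"
        by (intro min extend_prime[OF q(1)])
      then show ?thesis
        using contract_extend[of q] q(1) by (simp add: is_prime_ideal_def)
    qed
    then show ?thesis
      using prime_contract[OF hom prime] by (simp add: min_primes_def)
  qed
  then show "(\<lambda>Q. h -` Q) ` min_primes \<subseteq> min_primes"
    by blast
qed

lemma Nil_set_subset_contract: "Nil_set \<subseteq> h -` Nil_set"
proof
  fix s :: 'a
  assume "s \<in> Nil_set"
  then obtain n where "s ^ n = 0"
    unfolding Nil_set_def by blast
  moreover have "h (s ^ n) = h s ^ n"
    using hom by (induction n) (auto simp: is_semiring_hom_def)
  ultimately have "h s ^ n = 0"
    using hom by (simp add: is_semiring_hom_def)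
  then show "s \<in> h -` Nil_set"
    unfolding Nil_set_def by blast
qed

lemma Nil_set_extend: "Nil_set = extend_ideal h Nil_set"
proof
  show "Nil_set \<subseteq> extend_ideal h Nil_set"
    using content_nilpotent by (auto simp: mem_extend_iff[OF is_ideal_Nil_set])
  show "extend_ideal h Nil_set \<subseteq> Nil_set"
    using Nil_set_subset_contract by (simp add: extend_subset_iff[OF is_ideal_Nil_set])
qed

lemma extend_eq_zero_iff:
  assumes "is_ideal I"
  shows "extend_ideal h I = {0} \<longleftrightarrow> I = {0}"
proof -
  have h0: "h 0 = 0"
    using hom by (simp add: is_semiring_hom_def)
  have zero: "is_ideal {0 :: 'a}"
    by (auto simp: is_ideal_def)
  have "extend_ideal h {0} \<subseteq> {0}"
    by (subst extend_subset_iff) (auto simp: is_ideal_def h0)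
  then have "extend_ideal h {0} = {0}"
    using ideal_zero[OF is_ideal_extend_ideal, of h "{0}"] by blast
  then show ?thesis
    using contract_extend[OF assms] contract_extend[OF zero] by metis
qed

lemma reduced_iff: "reduced TYPE('b) \<longleftrightarrow> reduced TYPE('a)"
  unfolding reduced_def
  using extend_eq_zero_iff[OF is_ideal_Nil_set] Nil_set_extend by simp

end

theorem corollary34:
  fixes h :: "'a::comm_semiring_1 \<Rightarrow> 'b::comm_semiring_1"
  assumes "content_semialgebra h"
  shows "bij_betw (\<lambda>p. extend_ideal h p) (min_primes :: 'a set set) (min_primes :: 'b set set) \<and>
         (Nil_set :: 'b set) = extend_ideal h (Nil_set :: 'a set) \<and>
         (reduced TYPE('b) \<longleftrightarrow> reduced TYPE('a))"
proof -
  obtain c where "is_semiring_hom h" "is_content_function h c"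
    using assms unfolding content_semialgebra_def by blast
  then interpret content_setting h c
    by unfold_locales
  show ?thesis
    using bij_betw_min_primes Nil_set_extend reduced_iff by blast
qed

end
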